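(* Let $D$ be a division ring with center $Z(D)$ and let $F\subset Z(D)$ be a subfield, so that $D$ is an algebra over $F$. If $F\neq Z(D)$, then there exists a map $f:D\to D$ which is linear over $F$ but is not linear over the field $Z(D)$.
   Context: A map $f:D\to D$ is linear over a field $K\subset Z(D)$ if $f(a+b)=f(a)+f(b)$ and $f(pa)=pf(a)$ for all $a,b\in D$, $p\in K$. *)

theory Defs
  imports "HOL-Algebra.Subrings"
begin

text \<open>The axiom excludes the zero ring, in which \<open>\<zero> = \<one>\<close> is a unit.
  The name avoids a clash with the type class \<^class>\<open>division_ring\<close>.\<close>

locale skew_field = ring R for R (structure) +
  assumes skew_field_Units: "Units R = carrier R - {\<zero>}"

definition ring_center :: "('a, 'm) ring_scheme \<Rightarrow> 'a set"
  where "ring_center R = {z \<in> carrier R. \<forall>x \<in> carrier R. z \<otimes>\<^bsub>R\<^esub> x = x \<otimes>\<^bsub>R\<^esub> z}"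

text \<open>Only meant for a map \<open>f \<in> carrier R \<rightarrow> carrier R\<close> and a subfield \<open>K \<subseteq> ring_center R\<close>.
  These side conditions are not part of the definition, so that the negation of
  \<open>linear_over R K f\<close> says exactly that one of the two equations fails.\<close>

definition linear_over :: "('a, 'm) ring_scheme \<Rightarrow> 'a set \<Rightarrow> ('a \<Rightarrow> 'a) \<Rightarrow> bool"
  where "linear_over R K f \<longleftrightarrow>
    (\<forall>a \<in> carrier R. \<forall>b \<in> carrier R. f (a \<oplus>\<^bsub>R\<^esub> b) = f a \<oplus>\<^bsub>R\<^esub> f b) \<and>
    (\<forall>p \<in> K. \<forall>a \<in> carrier R. f (p \<otimes>\<^bsub>R\<^esub> a) = p \<otimes>\<^bsub>R\<^esub> f a)"

text \<open>The center is a legitimate field of scalars.\<close>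

lemma (in skew_field) subfield_ring_center: "subfield (ring_center R) R"
proof -
  let ?Z = "ring_center R"
  have carr: "z \<in> carrier R" if "z \<in> ?Z" for z
    using that unfolding ring_center_def by blast
  have comm: "z \<otimes> x = x \<otimes> z" if "z \<in> ?Z" "x \<in> carrier R" for z x
    using that unfolding ring_center_def by blast
  have memI: "z \<in> ?Z" if "z \<in> carrier R" "\<And>x. x \<in> carrier R \<Longrightarrow> z \<otimes> x = x \<otimes> z" for z
    using that unfolding ring_center_def by blast
  have one: "\<one> \<in> ?Z"
    by (rule memI) simp_all
  have nz: "\<one> \<noteq> \<zero>"
    using Units_one_closed unfolding skew_field_Units by blast
  have mult: "h \<otimes> k \<in> ?Z" if h: "h \<in> ?Z" and k: "k \<in> ?Z" for h k
  proof (rule memI)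
    show "h \<otimes> k \<in> carrier R" using carr[OF h] carr[OF k] by (rule m_closed)
    fix x assume x: "x \<in> carrier R"
    have "(h \<otimes> k) \<otimes> x = h \<otimes> (x \<otimes> k)"
      by (simp only: m_assoc[OF carr[OF h] carr[OF k] x] comm[OF k x])
    also have "\<dots> = (x \<otimes> h) \<otimes> k"
      by (simp only: m_assoc[OF carr[OF h] x carr[OF k], symmetric] comm[OF h x])
    also have "\<dots> = x \<otimes> (h \<otimes> k)"
      by (rule m_assoc[OF x carr[OF h] carr[OF k]])
    finally show "(h \<otimes> k) \<otimes> x = x \<otimes> (h \<otimes> k)" .
  qed
  have sub: "subring ?Z R"
  proof (rule subringI)
    show "?Z \<subseteq> carrier R" using carr by blast
    show "\<ominus> h \<in> ?Z" if h: "h \<in> ?Z" for h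
      by (rule memI) (simp_all add: carr[OF h] l_minus r_minus comm[OF h])
    show "h \<oplus> k \<in> ?Z" if h: "h \<in> ?Z" and k: "k \<in> ?Z" for h k
    proof (rule memI)
      show "h \<oplus> k \<in> carrier R" using carr[OF h] carr[OF k] by (rule a_closed)
      fix x assume x: "x \<in> carrier R"
      show "(h \<oplus> k) \<otimes> x = x \<otimes> (h \<oplus> k)"
        by (simp only: l_distr[OF carr[OF h] carr[OF k] x]
            r_distr[OF carr[OF h] carr[OF k] x] comm[OF h x] comm[OF k x])
    qed
  qed (fact one, fact mult)
  have inv_mem: "inv z \<in> ?Z" if z: "z \<in> ?Z" and u: "z \<in> Units R" for z
  proof (rule memI)
    show i: "inv z \<in> carrier R" using u by (rule Units_inv_closed)
    fix x assume x: "x \<in> carrier R"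
    have "inv z \<otimes> x = inv z \<otimes> (x \<otimes> (z \<otimes> inv z))"
      using x by (simp only: Units_r_inv[OF u] r_one)
    also have "\<dots> = inv z \<otimes> ((z \<otimes> x) \<otimes> inv z)"
      by (simp only: m_assoc[OF x carr[OF z] i, symmetric] comm[OF z x])
    also have "\<dots> = (inv z \<otimes> z) \<otimes> (x \<otimes> inv z)"
      by (simp only: m_assoc[OF carr[OF z] x i] m_assoc[OF i carr[OF z] m_closed[OF x i]])
    also have "\<dots> = x \<otimes> inv z"
      using x i by (simp only: Units_l_inv[OF u] l_one m_closed)
    finally show "inv z \<otimes> x = x \<otimes> inv z" .
  qed
  have unit: "z \<in> Units R" if "z \<in> ?Z" "z \<noteq> \<zero>" for z
    using that carr unfolding skew_field_Units by blast
  have integral: "a = \<zero> \<or> b = \<zero>" if "a \<in> ?Z" "b \<in> ?Z" "a \<otimes> b = \<zero>" for a b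
    using that unit Units_m_closed[of a b] unfolding skew_field_Units by blast
  have "subcring ?Z R"
    using sub comm carr by (blast intro: subcringI)
  then have "subdomain ?Z R"
    using nz integral unfolding subdomain_def subdomain_axioms_def by blast
  moreover have "Units (R\<lparr>carrier := ?Z\<rparr>) = ?Z - {\<zero>}"
  proof
    show "Units (R\<lparr>carrier := ?Z\<rparr>) \<subseteq> ?Z - {\<zero>}"
      using nz carr by (auto simp: Units_def)
    show "?Z - {\<zero>} \<subseteq> Units (R\<lparr>carrier := ?Z\<rparr>)"
    proof
      fix z assume "z \<in> ?Z - {\<zero>}"
      then have z: "z \<in> ?Z" and u: "z \<in> Units R" using unit by auto
      show "z \<in> Units (R\<lparr>carrier := ?Z\<rparr>)"
        using z inv_mem[OF z u] Units_l_inv[OF u] Units_r_inv[OF u]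
        unfolding Units_def[of "R\<lparr>carrier := ?Z\<rparr>"] by auto
    qed
  qed
  ultimately show ?thesis
    unfolding subfield_def subfield_axioms_def by blast
qed

end

theory Submission
  imports Defs "HOL-Algebra.Embedded_Algebras"
begin

text \<open>Pick a central element \<open>z\<close> outside \<open>F\<close>. A map that is linear over the center sends \<open>z\<close> to
  \<open>z\<close> times its value at \<open>\<one>\<close>, so it cannot vanish at \<open>z\<close> and be \<open>\<one>\<close> at \<open>\<one>\<close>. Over \<open>F\<close>
  alone nothing forbids this: \<open>\<one>\<close> does not lie on the line \<open>F z\<close>, since \<open>\<one> = c \<otimes> z\<close> with
  \<open>c \<in> F\<close> would make \<open>z\<close> the inverse of \<open>c\<close>, hence an element of \<open>F\<close>. So there is an
  \<open>F\<close>-linear functional with value \<open>\<one>\<close> at \<open>\<one>\<close> that kills \<open>z\<close>; as its values lie in \<open>F\<close>, it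
  is also a map from \<open>D\<close> to itself.

  The functional comes from the separation lemma \<open>separating_functional\<close>. Instead of extending a
  basis, its proof takes a subspace \<open>W\<close> that is maximal among those containing the given subspace
  and avoiding the given vector \<open>u\<close>. Maximality makes \<open>W\<close> a hyperplane complementary to the line
  \<open>K u\<close>, and the functional is the coordinate along \<open>u\<close>.\<close>

definition (in ring) linear_subspace :: "'a set \<Rightarrow> 'a set \<Rightarrow> bool"
  where "linear_subspace K W \<longleftrightarrow>
    subgroup W (add_monoid R) \<and> (\<forall>k \<in> K. \<forall>w \<in> W. k \<otimes> w \<in> W)"

context ring
begin

lemma linear_subspaceD:
  assumes "linear_subspace K W"
  shows "W \<subseteq> carrier R"
    and "\<zero> \<in> W"
    and "\<And>v w. v \<in> W \<Longrightarrow> w \<in> W \<Longrightarrow> v \<oplus> w \<in> W"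
    and "\<And>w. w \<in> W \<Longrightarrow> \<ominus> w \<in> W"
    and "\<And>k w. k \<in> K \<Longrightarrow> w \<in> W \<Longrightarrow> k \<otimes> w \<in> W"
proof -
  have W: "subgroup W (add_monoid R)"
    using assms unfolding linear_subspace_def by blast
  show "W \<subseteq> carrier R" "\<And>v w. v \<in> W \<Longrightarrow> w \<in> W \<Longrightarrow> v \<oplus> w \<in> W" "\<And>w. w \<in> W \<Longrightarrow> \<ominus> w \<in> W"
    using add.subgroupE[OF W] by auto
  show "\<zero> \<in> W"
    using subgroup.one_closed[OF W] by simp
  show "\<And>k w. k \<in> K \<Longrightarrow> w \<in> W \<Longrightarrow> k \<otimes> w \<in> W"
    using assms unfolding linear_subspace_def by blast
qed

lemma linear_subspace_line_extension:
  assumes K: "subfield K R" and W: "linear_subspace K W" and a: "a \<in> carrier R"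
  shows "linear_subspace K (line_extension K a W)"
  using line_extension_is_subgroup[OF K _ a] W
    line_extension_smult_closed[OF K linear_subspaceD(5)[OF W] linear_subspaceD(1)[OF W] a]
  unfolding linear_subspace_def by blast

lemma linear_subspace_zero:
  assumes "K \<subseteq> carrier R"
  shows "linear_subspace K {\<zero>}"
  using assms normal_imp_subgroup[OF add.one_is_normal]
  unfolding linear_subspace_def by auto

lemma linear_subspace_Union_chain:
  assumes "C \<noteq> {}" and "subset.chain {W. linear_subspace K W} C"
  shows "linear_subspace K (\<Union>C)"
proof -
  have sub: "linear_subspace K W" if "W \<in> C" for W
    using assms(2) that unfolding subset.chain_def by blast
  have "subgroup (\<Union>C) (add_monoid R)"
  proof (rule add.subgroupI)
    fix v w assume "v \<in> \<Union>C" "w \<in> \<Union>C"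
    then obtain V W where V: "V \<in> C" "v \<in> V" and W: "W \<in> C" "w \<in> W" by blast
    have "V \<subseteq> W \<or> W \<subseteq> V"
      using assms(2) V(1) W(1) unfolding subset_chain_def by blast
    then show "v \<oplus> w \<in> \<Union>C"
      using V W linear_subspaceD(3)[OF sub] by blast
  next
    show "\<Union>C \<subseteq> carrier R"
      using linear_subspaceD(1)[OF sub] by blast
    show "\<Union>C \<noteq> {}"
      using linear_subspaceD(2)[OF sub] assms(1) by blast
    show "\<ominus> w \<in> \<Union>C" if "w \<in> \<Union>C" for w
      using linear_subspaceD(4)[OF sub] that by blast
  qed
  then show ?thesis
    using linear_subspaceD(5)[OF sub] unfolding linear_subspace_def by blast
qed

text \<open>Zorn's lemma applies because the union of a chain of subspaces avoiding \<open>u\<close> is again one.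
  A maximal such \<open>W\<close> has codimension one: adjoining any \<open>a \<notin> W\<close> must capture \<open>u\<close>, and in the
  resulting equation \<open>u = k \<otimes> a \<oplus> w\<close> the scalar \<open>k\<close> is invertible, so \<open>a\<close> can be solved for.\<close>

lemma complement_of_line:
  assumes K: "subfield K R" and E: "linear_subspace K E" and u: "u \<in> carrier R" "u \<notin> E"
  obtains W where "linear_subspace K W" "E \<subseteq> W" "u \<notin> W" "line_extension K u W = carrier R"
proof -
  define A where "A = {W. linear_subspace K W \<and> E \<subseteq> W \<and> u \<notin> W}"
  have "\<Union>C \<in> A" if "C \<noteq> {}" "subset.chain A C" for C
  proof -
    have C: "C \<subseteq> A"
      using that(2) unfolding subset.chain_def by blast
    have "subset.chain {W. linear_subspace K W} C"
      using that(2) unfolding A_def subset_chain_def by blast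
    then show ?thesis
      using linear_subspace_Union_chain[OF that(1)] C that(1) unfolding A_def by blast
  qed
  moreover have "A \<noteq> {}"
    using E u(2) unfolding A_def by blast
  ultimately obtain W where "W \<in> A" and max: "\<And>V. V \<in> A \<Longrightarrow> W \<subseteq> V \<Longrightarrow> V = W"
    using subset_Zorn_nonempty[of A] by metis
  then have W: "linear_subspace K W" and EW: "E \<subseteq> W" and uW: "u \<notin> W"
    unfolding A_def by auto
  note Wp = linear_subspaceD[OF W]
  note Kp = subringE[OF subfieldE(1)[OF K]]
  have "a \<in> line_extension K u W" if a: "a \<in> carrier R" for a
  proof (cases "a \<in> W")
    case True
    have "a = \<zero> \<otimes> u \<oplus> a"
      using a u(1) by simp
    then show ?thesis
      using True Kp(2) unfolding line_extension_mem_iff by blast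
  next
    case False
    let ?V = "line_extension K a W"
    have "w = \<zero> \<otimes> a \<oplus> w" if "w \<in> W" for w
      using that a Wp(1) by auto
    then have WV: "W \<subseteq> ?V"
      using Kp(2) unfolding line_extension_mem_iff subset_iff by blast
    have "a = \<one> \<otimes> a \<oplus> \<zero>"
      using a by simp
    then have "a \<in> ?V"
      using Kp(3) Wp(2) unfolding line_extension_mem_iff by blast
    then have "?V \<notin> A"
      using max[OF _ WV] False by blast
    then have "u \<in> ?V"
      using linear_subspace_line_extension[OF K W a] EW WV unfolding A_def by blast
    then obtain k w where k: "k \<in> K" and w: "w \<in> W" and uk: "u = k \<otimes> a \<oplus> w"
      unfolding line_extension_mem_iff by blast
    have wc: "w \<in> carrier R"
      using w Wp(1) by blast
    have "k \<noteq> \<zero>"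
      using uk a w wc uW by auto
    then have i: "inv k \<in> K" "inv k \<otimes> k = \<one>"
      using subfield_m_inv[OF K, of k] k by auto
    have c: "k \<in> carrier R" "inv k \<in> carrier R"
      using k i Kp(1) by auto
    have "inv k \<otimes> u \<oplus> (\<ominus> (inv k \<otimes> w)) = (inv k \<otimes> k) \<otimes> a"
      unfolding uk using c a wc by (simp add: r_distr m_assoc a_assoc r_neg)
    then have "a = inv k \<otimes> u \<oplus> (\<ominus> (inv k \<otimes> w))"
      using i(2) a by simp
    then show ?thesis
      using i(1) Wp(4)[OF Wp(5)[OF i(1) w]] unfolding line_extension_mem_iff by blast
  qed
  then have "line_extension K u W = carrier R"
    using line_extension_in_carrier[OF Kp(1) u(1) Wp(1)] by blast
  then show thesis
    using that W EW uW by blast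
qed

lemma line_coordinate_unique:
  assumes K: "subfield K R" and W: "linear_subspace K W" and u: "u \<in> carrier R" "u \<notin> W"
    and "k \<in> K" "l \<in> K" "v \<in> W" "w \<in> W" and eq: "k \<otimes> u \<oplus> v = l \<otimes> u \<oplus> w"
  shows "k = l"
proof (rule ccontr)
  assume "k \<noteq> l"
  note Wp = linear_subspaceD[OF W]
  note Kp = subringE[OF subfieldE(1)[OF K]]
  have c: "k \<in> carrier R" "l \<in> carrier R" "v \<in> carrier R" "w \<in> carrier R"
    using assms(5-8) Kp(1) Wp(1) by auto
  let ?d = "k \<oplus> \<ominus> l"
  have d: "?d \<in> K"
    using Kp(7)[OF assms(5) Kp(5)[OF assms(6)]] .
  have "?d \<noteq> \<zero>"
    using \<open>k \<noteq> l\<close> c r_right_minus_eq[of k l] by (simp add: minus_eq)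
  then have i: "inv ?d \<in> K" "inv ?d \<otimes> ?d = \<one>"
    using subfield_m_inv[OF K, of ?d] d by auto
  have "?d \<otimes> u = (k \<otimes> u \<oplus> v) \<oplus> (\<ominus> (l \<otimes> u) \<oplus> \<ominus> v)"
    using c u(1) by algebra
  also have "\<dots> = w \<oplus> \<ominus> v"
    unfolding eq using c u(1) by algebra
  finally have "?d \<otimes> u \<in> W"
    using Wp assms(7,8) by auto
  then have "inv ?d \<otimes> (?d \<otimes> u) \<in> W"
    using Wp(5) i(1) by blast
  moreover have "inv ?d \<otimes> (?d \<otimes> u) = (inv ?d \<otimes> ?d) \<otimes> u"
    using m_assoc[OF subsetD[OF Kp(1) i(1)] subsetD[OF Kp(1) d] u(1)] by (rule sym)
  ultimately show False
    using i(2) u by simp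
qed

text \<open>The linear-algebra form of Hahn--Banach separation, for a possibly infinite-dimensional
  left vector space: the functional is the coordinate along \<open>u\<close> in a decomposition of the whole
  space into the line \<open>K u\<close> and a complement containing \<open>E\<close>.\<close>

lemma separating_functional:
  assumes K: "subfield K R" and E: "linear_subspace K E" and u: "u \<in> carrier R" "u \<notin> E"
  obtains f where "f \<in> carrier R \<rightarrow> K" "linear_over R K f" "f u = \<one>" "\<And>e. e \<in> E \<Longrightarrow> f e = \<zero>"
proof -
  obtain W where W: "linear_subspace K W" "E \<subseteq> W" "u \<notin> W"
    and full: "line_extension K u W = carrier R"
    using complement_of_line[OF K E u] .
  note Wp = linear_subspaceD[OF W(1)]
  note Kp = subringE[OF subfieldE(1)[OF K]]
  define f where "f a = (THE k. k \<in> K \<and> (\<exists>w \<in> W. a = k \<otimes> u \<oplus> w))" for a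
  have f_eq: "f (k \<otimes> u \<oplus> w) = k" if "k \<in> K" "w \<in> W" for k w
    unfolding f_def using that line_coordinate_unique[OF K W(1) u(1) W(3)] by blast
  have split: "\<exists>k \<in> K. \<exists>w \<in> W. a = k \<otimes> u \<oplus> w" if "a \<in> carrier R" for a
    using that line_extension_mem_iff[of a K u W] unfolding full by blast
  show thesis
  proof (rule that)
    show "f \<in> carrier R \<rightarrow> K"
      using split f_eq by fastforce
    show "f u = \<one>"
      using f_eq[OF Kp(3) Wp(2)] u(1) by simp
    show "f e = \<zero>" if "e \<in> E" for e
    proof -
      have e: "e \<in> W" "e \<in> carrier R"
        using that W(2) Wp(1) by auto
      show ?thesis
        using f_eq[OF Kp(2) e(1)] e(2) u(1) by simp
    qed
    show "linear_over R K f"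
      unfolding linear_over_def
    proof (intro conjI ballI)
      fix a b assume "a \<in> carrier R" "b \<in> carrier R"
      then obtain k v l w where k: "k \<in> K" "v \<in> W" "a = k \<otimes> u \<oplus> v"
        and l: "l \<in> K" "w \<in> W" "b = l \<otimes> u \<oplus> w"
        using split by meson
      have c: "k \<in> carrier R" "l \<in> carrier R" "v \<in> carrier R" "w \<in> carrier R"
        using k l Kp(1) Wp(1) by auto
      have "a \<oplus> b = (k \<oplus> l) \<otimes> u \<oplus> (v \<oplus> w)"
        unfolding k(3) l(3) using c u(1) by algebra
      then show "f (a \<oplus> b) = f a \<oplus> f b"
        using f_eq k l Kp(7) Wp(3) by simp
    next
      fix p a assume p: "p \<in> K" and "a \<in> carrier R"
      then obtain k w where k: "k \<in> K" "w \<in> W" "a = k \<otimes> u \<oplus> w"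
        using split by meson
      have c: "p \<in> carrier R" "k \<in> carrier R" "w \<in> carrier R"
        using p k Kp(1) Wp(1) by auto
      have "p \<otimes> a = (p \<otimes> k) \<otimes> u \<oplus> p \<otimes> w"
        unfolding k(3) using c u(1) by algebra
      then show "f (p \<otimes> a) = p \<otimes> f a"
        using f_eq k p Kp(6) Wp(5) by simp
    qed
  qed
qed

end

theorem theorem3p1p4:
  fixes D :: "('a, 'm) ring_scheme" and F :: "'a set"
  assumes "skew_field D"
    and "subfield F D"
    and "F \<subseteq> ring_center D"
    and "F \<noteq> ring_center D"
  shows "\<exists>f. f \<in> carrier D \<rightarrow> carrier D \<and> linear_over D F f \<and>
           \<not> linear_over D (ring_center D) f"
proof -
  interpret skew_field D by fact
  note Fp = subringE[OF subfieldE(1)[OF assms(2)]]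
  obtain z where z: "z \<in> ring_center D" "z \<notin> F"
    using assms(3,4) by blast
  have zc: "z \<in> carrier D"
    using z(1) unfolding ring_center_def by blast
  let ?E = "line_extension F z {\<zero>\<^bsub>D\<^esub>}"
  have E: "linear_subspace F ?E"
    using linear_subspace_line_extension[OF assms(2) linear_subspace_zero[OF Fp(1)] zc] .
  have "\<one>\<^bsub>D\<^esub> \<notin> ?E"
  proof
    assume "\<one>\<^bsub>D\<^esub> \<in> ?E"
    then obtain c where c: "c \<in> F" "\<one>\<^bsub>D\<^esub> = c \<otimes>\<^bsub>D\<^esub> z"
      using zc Fp(1) by (auto simp: line_extension_mem_iff)
    then have "c \<noteq> \<zero>\<^bsub>D\<^esub>"
      using zc subfieldE(6)[OF assms(2)] by auto
    then show False
      using subfield_m_inv_simprule[OF assms(2), of c z] c zc Fp(3) z(2) by auto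
  qed
  then obtain f where f: "f \<in> carrier D \<rightarrow> F" "linear_over D F f" "f \<one>\<^bsub>D\<^esub> = \<one>\<^bsub>D\<^esub>"
    and fE: "\<And>e. e \<in> ?E \<Longrightarrow> f e = \<zero>\<^bsub>D\<^esub>"
    using separating_functional[OF assms(2) E one_closed] by blast
  have "z = \<one>\<^bsub>D\<^esub> \<otimes>\<^bsub>D\<^esub> z \<oplus>\<^bsub>D\<^esub> \<zero>\<^bsub>D\<^esub>"
    using zc by simp
  then have "f z = \<zero>\<^bsub>D\<^esub>"
    using fE Fp(3) unfolding line_extension_mem_iff by blast
  moreover have "z \<noteq> \<zero>\<^bsub>D\<^esub>"
    using z(2) Fp(2) by blast
  ultimately have "f (z \<otimes>\<^bsub>D\<^esub> \<one>\<^bsub>D\<^esub>) \<noteq> z \<otimes>\<^bsub>D\<^esub> f \<one>\<^bsub>D\<^esub>"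
    using zc f(3) by simp
  then have "\<not> linear_over D (ring_center D) f"
    using z(1) one_closed unfolding linear_over_def by blast
  then show ?thesis
    using f(1,2) Fp(1) by blast
qed

end
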